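(* For every integer $n\ge 1$ and every $x\in\{a,b,c\}$, the genus $4$ trisection diagrams $\mathcal{D}_x\cup\mathcal{D}_{S(t(2n+1,2))}$ and $\overline{\mathcal{D}_x}\cup\mathcal{D}_{S(t(2n+1,2))}$ of $S^4$, obtained by the Gluck surgery along the spun $(2n+1,2)$-torus knot $S(t(2n+1,2))$ and whose curves have the homology classes listed in the context, are homologically standard.
   Context: **Origin of the diagrams.** A trisection diagram is a tuple $(\Sigma;\alpha,\beta,\gamma)$ where $\Sigma$ is a closed oriented genus $g$ surface and $\alpha=\{\alpha_1,\dots,\alpha_g\}$, $\beta=\{\beta_1,\dots,\beta_g\}$, $\gamma=\{\gamma_1,\dots,\gamma_g\}$ are systems of disjoint simple closed curves, any two of which form a Heegaard diagram of some $\#^{k}S^1\times S^2$. $\mathcal{D}_{S(t(2n+1,2))}$ is the arced relative trisection diagram (a genus $3$ surface with two boundary components, three curves and one arc for each of $\alpha,\beta,\gamma$) of the complement in $S^4$ of the spin of the $(2n+1,2)$-torus knot, obtained by Meier's spinning construction from a genus $1$ doubly pointed Heegaard diagram of $(S^3,t(2n+1,2))$. For $x\in\{a,b,c\}$, $\mathcal{D}_x$ is an annulus with three arcs labelled $a,b,c$ joining its two boundary components, two of them parallel and the one labelled $x$ differing from these by one Dehn twist along the core; $\overline{\mathcal{D}_x}$ is the same with the Dehn twist of opposite handedness. Gluing along the boundary with matching arcs gives a closed genus $4$ surface $\Sigma$ with four curves in each family, the fourth curve being the union of the two arcs of that family. This is a trisection diagram of the Gluck surgery on $S^4$ along $S(t(2n+1,2))$,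 which is diffeomorphic to $S^4$. Homological standardness (defined below) depends only on the homology classes of the curves, which are as follows. **Homology classes.** There is a basis $e_1,\dots,e_8$ of $H_1(\Sigma;\mathbb{Z})\cong\mathbb{Z}^8$ with algebraic intersection form $\langle e_i,e_{i+4}\rangle=1=-\langle e_{i+4},e_i\rangle$ for $1\le i\le 4$ and all other pairings of basis elements zero (up to an overall sign), such that, for suitable orientations, - $[\alpha_1]=(0,0,-1,-1,0,0,0,0)$, $[\alpha_2]=(1,0,-1,0,0,0,0,0)$, $[\alpha_3]=(0,0,0,0,0,1,0,0)$, $[\alpha_4]=(1,0,-2(1+n),3+2n+p,1,1,1,-1)$; - $[\beta_1]=(0,-1,0,-1,0,0,0,0)$, $[\beta_2]=(0,1,-1,0,0,0,0,0)$, $[\beta_3]=(0,0,0,0,1,0,0,0)$, $[\beta_4]=(0,0,-(1+2n),3+2n+q,1,1,1,-1)$; - $[\gamma_1]=(0,-1,0,-1,0,0,0,0)$, $[\gamma_2]=(1,-1,0,0,0,0,0,0)$, $[\gamma_3]=(0,0,0,0,0,0,1,0)$, $[\gamma_4]=(0,-(1+2n),0,3+2n+r,1,1,1,-1)$; where $(p,q,r)=(1,0,0),(0,1,0),(0,0,1)$ for $\mathcal{D}_a,\mathcal{D}_b,\mathcal{D}_c$ respectively, and $(p,q,r)=(-1,0,0),(0,-1,0),(0,0,-1)$ for $\overline{\mathcal{D}_a},\overline{\mathcal{D}_b},\overline{\mathcal{D}_c}$ respectively. **Homological moves.** A *homological handle slide* of $[C_1]$ over $[C_2]$, where $C_1,C_2$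 are distinct members of the same family ($\alpha$, $\beta$ or $\gamma$), replaces $[C_1]$ by $[C_1]\pm[C_2]$. A *homological Dehn twist* along a nontrivial class $[C]\in H_1(\Sigma)$ (the class of a simple closed curve) replaces the class $[C_1]$ of every curve of the diagram, in all three families simultaneously and with the same sign, by $[C_1]\pm\langle [C_1],[C]\rangle[C]$. **Homologically standard.** A trisection diagram $(\Sigma;\alpha,\beta,\gamma)$ of $S^4$ is *homologically standard* if, after finitely many homological Dehn twists and homological handle slides, and after re-indexing the curves within each of the three families, for each $i\in\{1,\dots,g\}$ one of the following holds (for all $j\neq i$): - $\langle[\alpha_i],[\beta_i]\rangle=\langle[\alpha_i],[\gamma_i]\rangle=\pm1$, $\langle[\alpha_i],[\beta_j]\rangle=\langle[\gamma_i],[\beta_j]\rangle=0$ and $[\beta_i]=[\gamma_i]$ in $H_1(\Sigma)$; - $\langle[\beta_i],[\gamma_i]\rangle=\langle[\beta_i],[\alpha_i]\rangle=\pm1$, $\langle[\beta_i],[\gamma_j]\rangle=\langle[\beta_i],[\alpha_j]\rangle=0$ and $[\gamma_i]=[\alpha_i]$ in $H_1(\Sigma)$; - $\langle[\gamma_i],[\alpha_i]\rangle=\langle[\gamma_i],[\beta_i]\rangle=\pm1$, $\langle[\gamma_i],[\alpha_j]\rangle=\langle[\gamma_i],[\beta_j]\rangle=0$ and $[\alpha_i]=[\beta_i]$ in $H_1(\Sigma)$. *)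

theory Defs
  imports "HOL-Analysis.Analysis"
begin

(* Homological standardness of a trisection diagram depends only on the classes of its
   (oriented) curves in H_1(Sigma; Z), so a genus g diagram is represented by three families
   of g vectors in Z^m, m = 2g (alpha, beta, gamma in this order).  CARD('g) is the genus,
   CARD('m) the rank of H_1(Sigma), and \<omega> the algebraic intersection form. *)

type_synonym ('m, 'g) curves = "int ^ 'm ^ 'g"
type_synonym ('m, 'g) diagram = "('m, 'g) curves \<times> ('m, 'g) curves \<times> ('m, 'g) curves"
type_synonym 'm form = "int ^ 'm \<Rightarrow> int ^ 'm \<Rightarrow> int"

(* A nonzero class in H_1 of a closed oriented surface is the class of a simple closed curve
   if and only if it is primitive, i.e. divisible only by 1 and -1.  Note that the zero vector
   is not primitive in this sense. *)
definition primitive_class :: "int ^ 'm::finite \<Rightarrow> bool" where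
  "primitive_class c \<longleftrightarrow> (\<forall>k d. c = k *s d \<longrightarrow> k \<in> {1, -1})"

definition handle_slide :: "'g::finite \<Rightarrow> 'g \<Rightarrow> int \<Rightarrow> ('m::finite, 'g) curves \<Rightarrow> ('m, 'g) curves" where
  "handle_slide i j s F = (\<chi> k. if k = i then F $ i + s *s F $ j else F $ k)"

definition dehn_twist :: "'m::finite form \<Rightarrow> int ^ 'm \<Rightarrow> int \<Rightarrow> ('m, 'g::finite) curves \<Rightarrow> ('m, 'g) curves" where
  "dehn_twist \<omega> c s F = (\<chi> k. F $ k + (s * \<omega> (F $ k) c) *s c)"

inductive homological_move :: "'m::finite form \<Rightarrow> ('m, 'g::finite) diagram \<Rightarrow> ('m, 'g) diagram \<Rightarrow> bool"
  for \<omega> :: "'m::finite form" where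
  slide_alpha: "i \<noteq> j \<Longrightarrow> s \<in> {1, -1} \<Longrightarrow>
    homological_move \<omega> (\<alpha>, \<beta>, \<gamma>) (handle_slide i j s \<alpha>, \<beta>, \<gamma>)"
| slide_beta: "i \<noteq> j \<Longrightarrow> s \<in> {1, -1} \<Longrightarrow>
    homological_move \<omega> (\<alpha>, \<beta>, \<gamma>) (\<alpha>, handle_slide i j s \<beta>, \<gamma>)"
| slide_gamma: "i \<noteq> j \<Longrightarrow> s \<in> {1, -1} \<Longrightarrow>
    homological_move \<omega> (\<alpha>, \<beta>, \<gamma>) (\<alpha>, \<beta>, handle_slide i j s \<gamma>)"
| twist: "primitive_class c \<Longrightarrow> s \<in> {1, -1} \<Longrightarrow>
    homological_move \<omega> (\<alpha>, \<beta>, \<gamma>) (dehn_twist \<omega> c s \<alpha>, dehn_twist \<omega> c s \<beta>, dehn_twist \<omega> c s \<gamma>)"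

definition reindex :: "('g::finite \<Rightarrow> 'g) \<Rightarrow> ('m::finite, 'g) curves \<Rightarrow> ('m, 'g) curves" where
  "reindex \<pi> F = (\<chi> i. F $ \<pi> i)"

definition standard_at :: "'m::finite form \<Rightarrow> ('m, 'g::finite) diagram \<Rightarrow> 'g \<Rightarrow> bool" where
  "standard_at \<omega> D i \<longleftrightarrow> (case D of (\<alpha>, \<beta>, \<gamma>) \<Rightarrow>
     (\<omega> (\<alpha> $ i) (\<beta> $ i) = \<omega> (\<alpha> $ i) (\<gamma> $ i) \<and> \<omega> (\<alpha> $ i) (\<beta> $ i) \<in> {1, -1} \<and>
      (\<forall>j. j \<noteq> i \<longrightarrow> \<omega> (\<alpha> $ i) (\<beta> $ j) = 0 \<and> \<omega> (\<gamma> $ i) (\<beta> $ j) = 0) \<and>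
      \<beta> $ i = \<gamma> $ i) \<or>
     (\<omega> (\<beta> $ i) (\<gamma> $ i) = \<omega> (\<beta> $ i) (\<alpha> $ i) \<and> \<omega> (\<beta> $ i) (\<gamma> $ i) \<in> {1, -1} \<and>
      (\<forall>j. j \<noteq> i \<longrightarrow> \<omega> (\<beta> $ i) (\<gamma> $ j) = 0 \<and> \<omega> (\<beta> $ i) (\<alpha> $ j) = 0) \<and>
      \<gamma> $ i = \<alpha> $ i) \<or>
     (\<omega> (\<gamma> $ i) (\<alpha> $ i) = \<omega> (\<gamma> $ i) (\<beta> $ i) \<and> \<omega> (\<gamma> $ i) (\<alpha> $ i) \<in> {1, -1} \<and>
      (\<forall>j. j \<noteq> i \<longrightarrow> \<omega> (\<gamma> $ i) (\<alpha> $ j) = 0 \<and> \<omega> (\<gamma> $ i) (\<beta> $ j) = 0) \<and>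
      \<alpha> $ i = \<beta> $ i))"

definition homologically_standard :: "'m::finite form \<Rightarrow> ('m, 'g::finite) diagram \<Rightarrow> bool" where
  "homologically_standard \<omega> D \<longleftrightarrow>
    (\<exists>\<alpha> \<beta> \<gamma> \<pi>\<^sub>1 \<pi>\<^sub>2 \<pi>\<^sub>3. (homological_move \<omega>)\<^sup>*\<^sup>* D (\<alpha>, \<beta>, \<gamma>) \<and>
       bij \<pi>\<^sub>1 \<and> bij \<pi>\<^sub>2 \<and> bij \<pi>\<^sub>3 \<and>
       (\<forall>i. standard_at \<omega> (reindex \<pi>\<^sub>1 \<alpha>, reindex \<pi>\<^sub>2 \<beta>, reindex \<pi>\<^sub>3 \<gamma>) i))"

(* The intersection form on H_1 of the genus 4 surface in the basis e_1, ..., e_8, where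
   e_i = axis i 1 (in the type 8 the index 8 is the element 0).  The form is only specified up
   to an overall sign \<epsilon> = 1 or -1, which is kept as a parameter. *)
definition intersection_form :: "int \<Rightarrow> 8 form" where
  "intersection_form \<epsilon> x y = \<epsilon> * (\<Sum>i\<in>{1, 2, 3, 4}. x $ i * y $ (i + 4) - x $ (i + 4) * y $ i)"

(* Classes of the curves of the union of an arced annulus with the arced diagram of the complement
   of the spun (2n+1,2)-torus knot; (p, q, r) records the Dehn twist on the arc a, b or c of the
   annulus. *)
definition glued_diagram :: "int \<Rightarrow> int \<times> int \<times> int \<Rightarrow> (8, 4) diagram" where
  "glued_diagram n = (\<lambda>(p, q, r).
    (vector [vector [0, 0, -1, -1, 0, 0, 0, 0],
             vector [1, 0, -1, 0, 0, 0, 0, 0],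
             vector [0, 0, 0, 0, 0, 1, 0, 0],
             vector [1, 0, -2 * (1 + n), 3 + 2 * n + p, 1, 1, 1, -1]],
     vector [vector [0, -1, 0, -1, 0, 0, 0, 0],
             vector [0, 1, -1, 0, 0, 0, 0, 0],
             vector [0, 0, 0, 0, 1, 0, 0, 0],
             vector [0, 0, -(1 + 2 * n), 3 + 2 * n + q, 1, 1, 1, -1]],
     vector [vector [0, -1, 0, -1, 0, 0, 0, 0],
             vector [1, -1, 0, 0, 0, 0, 0, 0],
             vector [0, 0, 0, 0, 0, 0, 1, 0],
             vector [0, -(1 + 2 * n), 0, 3 + 2 * n + r, 1, 1, 1, -1]]))"

datatype arc_label = Arc_a | Arc_b | Arc_c

fun twist_on :: "arc_label \<Rightarrow> int \<Rightarrow> int \<times> int \<times> int" where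
  "twist_on Arc_a t = (t, 0, 0)"
| "twist_on Arc_b t = (0, t, 0)"
| "twist_on Arc_c t = (0, 0, t)"

(* The annulus diagram D_x has twist 1 on the arc x; its mirror, with the Dehn twist of opposite
   handedness, has twist -1. *)
definition gluck_diagram :: "arc_label \<Rightarrow> int \<Rightarrow> (8, 4) diagram" where
  "gluck_diagram x n = glued_diagram n (twist_on x 1)"

definition gluck_diagram_mirror :: "arc_label \<Rightarrow> int \<Rightarrow> (8, 4) diagram" where
  "gluck_diagram_mirror x n = glued_diagram n (twist_on x (-1))"

end

theory Submission
  imports Defs
begin

text \<open>
  Dehn twists act by isometries of the intersection form, so they cannot change whether the three
  Lagrangians spanned by the families have bases as in the definition of homological standardness.
  It is thus a question of finding good bases, and handle slides with a reindexing suffice.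

  Put \<open>f\<^sub>i = e\<^sub>i + e\<^sub>4\<close> for \<open>i = 1, 2, 3\<close> and
  \<open>v = (4n + 4) e\<^sub>4 + e\<^sub>5 + e\<^sub>6 + e\<^sub>7 - e\<^sub>8\<close>. Then the three families span
    \<^item> \<open>\<alpha>\<close>: \<open>f\<^sub>1, f\<^sub>3, e\<^sub>6, v + p e\<^sub>4\<close>;
    \<^item> \<open>\<beta>\<close>: \<open>f\<^sub>2, f\<^sub>3, e\<^sub>5, v + q e\<^sub>4\<close>;
    \<^item> \<open>\<gamma>\<close>: \<open>f\<^sub>1, f\<^sub>2, e\<^sub>7, v + r e\<^sub>4\<close>.

  Up to sign, the form pairs \<open>f\<^sub>i\<close> with \<open>e\<^bsub>i+4\<^esub>\<close> and \<open>v\<close> with \<open>e\<^sub>4\<close>, all other pairings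
  among these eight classes being zero. So the diagram is an orthogonal sum of four genus 1
  diagrams. In the first three, two families share the class \<open>f\<^sub>i\<close> and the third has its dual
  \<open>e\<^bsub>i+4\<^esub>\<close>. The fourth consists of \<open>v + p e\<^sub>4, v + q e\<^sub>4, v + r e\<^sub>4\<close>, whose pairings are, up to sign, the
  differences of \<open>p, q, r\<close>: a single Dehn twist on one of the arcs makes two of the three classes
  equal and the third one dual to them, whichever arc it is and whatever its handedness. The knot
  enters only through the coefficient \<open>4n + 4\<close>, common to the three classes and therefore
  invisible to the pairings.
\<close>

section \<open>Coordinates in rank 8\<close>

lemma exhaust_8:
  fixes x :: 8
  shows "x = 1 \<or> x = 2 \<or> x = 3 \<or> x = 4 \<or> x = 5 \<or> x = 6 \<or> x = 7 \<or> x = 8"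
proof (induct x)
  case (of_int z)
  then have "z = 0 \<or> z = 1 \<or> z = 2 \<or> z = 3 \<or> z = 4 \<or> z = 5 \<or> z = 6 \<or> z = 7" by fastforce
  then show ?case by auto
qed

lemma forall_8: "(\<forall>i::8. P i) \<longleftrightarrow> P 1 \<and> P 2 \<and> P 3 \<and> P 4 \<and> P 5 \<and> P 6 \<and> P 7 \<and> P 8"
  by (metis exhaust_8)

lemma vector_8:
  "(vector [a, b, c, d, e, f, g, h] :: 'a::zero ^ 8) $ 1 = a"
  "(vector [a, b, c, d, e, f, g, h] :: 'a ^ 8) $ 2 = b"
  "(vector [a, b, c, d, e, f, g, h] :: 'a ^ 8) $ 3 = c"
  "(vector [a, b, c, d, e, f, g, h] :: 'a ^ 8) $ 4 = d"
  "(vector [a, b, c, d, e, f, g, h] :: 'a ^ 8) $ 5 = e"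
  "(vector [a, b, c, d, e, f, g, h] :: 'a ^ 8) $ 6 = f"
  "(vector [a, b, c, d, e, f, g, h] :: 'a ^ 8) $ 7 = g"
  "(vector [a, b, c, d, e, f, g, h] :: 'a ^ 8) $ 8 = h"
  unfolding vector_def by simp_all

lemma vector_4:
  "(vector [a, b, c, d] :: 'a::zero ^ 4) $ 1 = a"
  "(vector [a, b, c, d] :: 'a ^ 4) $ 2 = b"
  "(vector [a, b, c, d] :: 'a ^ 4) $ 3 = c"
  "(vector [a, b, c, d] :: 'a ^ 4) $ 4 = d"
  unfolding vector_def by simp_all

lemma intersection_form_vector:
  "intersection_form \<epsilon> (vector [a1, a2, a3, a4, a5, a6, a7, a8])
                       (vector [b1, b2, b3, b4, b5, b6, b7, b8]) =
   \<epsilon> * (a1 * b5 + a2 * b6 + a3 * b7 + a4 * b8 - a5 * b1 - a6 * b2 - a7 * b3 - a8 * b4)"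
proof -
  have indices: "(1::8) + 4 = 5" "(2::8) + 4 = 6" "(3::8) + 4 = 7" "(4::8) + 4 = 8"
    by (simp_all only: one_plus_numeral numeral_plus_numeral add_num_simps)
  have "(\<Sum>i\<in>{1, 2, 3, 4::8}. g i) = g 1 + g 2 + g 3 + g 4" for g :: "8 \<Rightarrow> int"
    by (simp add: add.assoc)
  then show ?thesis
    unfolding intersection_form_def by (simp only: indices vector_8) (simp add: algebra_simps)
qed

section \<open>Multiple handle slides\<close>

text \<open>
  Sliding a curve repeatedly over another one adds any integer multiple of the class of the latter.
  The function \<open>put\<close> inserts a family into a diagram whose other two families are kept, so that the
  lemma applies to each of the three families.
\<close>

lemma multiple_handle_slide:
  fixes F :: "('m::finite, 'g::finite) curves" and k :: int
  assumes "i \<noteq> j"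
    and slide: "\<And>F s. s \<in> {1, -1} \<Longrightarrow> homological_move \<omega> (put F) (put (handle_slide i j s F))"
  shows "(homological_move \<omega>)\<^sup>*\<^sup>* (put F) (put (handle_slide i j k F))"
proof (induction k rule: int_induct[where k = 0])
  case base
  have "handle_slide i j 0 F = F"
    by (simp add: handle_slide_def vec_eq_iff)
  then show ?case by simp
next
  case (step1 k)
  have "handle_slide i j (k + 1) F = handle_slide i j 1 (handle_slide i j k F)"
    using \<open>i \<noteq> j\<close> by (simp add: handle_slide_def vec_eq_iff algebra_simps)
  then show ?case
    using step1.IH slide[of 1 "handle_slide i j k F"] by (simp add: rtranclp.rtrancl_into_rtrancl)
next
  case (step2 k)
  have "handle_slide i j (k - 1) F = handle_slide i j (-1) (handle_slide i j k F)"
    using \<open>i \<noteq> j\<close> by (simp add: handle_slide_def vec_eq_iff algebra_simps)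
  then show ?case
    using step2.IH slide[of "-1" "handle_slide i j k F"] by (simp add: rtranclp.rtrancl_into_rtrancl)
qed

lemma multiple_slide_alpha:
  "i \<noteq> j \<Longrightarrow> (homological_move \<omega>)\<^sup>*\<^sup>* (\<alpha>, \<beta>, \<gamma>) (handle_slide i j k \<alpha>, \<beta>, \<gamma>)"
  by (rule multiple_handle_slide[where put = "\<lambda>F. (F, \<beta>, \<gamma>)"]) (auto intro: slide_alpha)

lemma multiple_slide_beta:
  "i \<noteq> j \<Longrightarrow> (homological_move \<omega>)\<^sup>*\<^sup>* (\<alpha>, \<beta>, \<gamma>) (\<alpha>, handle_slide i j k \<beta>, \<gamma>)"
  by (rule multiple_handle_slide[where put = "\<lambda>F. (\<alpha>, F, \<gamma>)"]) (auto intro: slide_beta)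

lemma multiple_slide_gamma:
  "i \<noteq> j \<Longrightarrow> (homological_move \<omega>)\<^sup>*\<^sup>* (\<alpha>, \<beta>, \<gamma>) (\<alpha>, \<beta>, handle_slide i j k \<gamma>)"
  by (rule multiple_handle_slide[where put = "\<lambda>F. (\<alpha>, \<beta>, F)"]) (auto intro: slide_gamma)

lemma homologically_standard_if_moves:
  assumes "(homological_move \<omega>)\<^sup>*\<^sup>* D D'" and "homologically_standard \<omega> D'"
  shows "homologically_standard \<omega> D"
  using assms unfolding homologically_standard_def by (meson rtranclp_trans)

section \<open>Splitting into genus 1 summands\<close>

text \<open>
  The bases listed at the start, up to order and signs, with \<open>a\<close>, \<open>b\<close>, \<open>c\<close> in place of \<open>4n + 4 + p\<close>, \<open>4n + 4 + q\<close>,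
  \<open>4n + 4 + r\<close>. The order of the curves and the signs, which agree whenever two families share a
  class, are those produced by the slides below.
\<close>

definition split_diagram :: "int \<Rightarrow> int \<Rightarrow> int \<Rightarrow> (8, 4) diagram" where
  "split_diagram a b c =
    (vector [vector [0, 0, -1, -1, 0, 0, 0, 0],
             vector [1, 0, 0, 1, 0, 0, 0, 0],
             vector [0, 0, 0, 0, 0, 1, 0, 0],
             vector [0, 0, 0, a, 1, 1, 1, -1]],
     vector [vector [0, -1, 0, -1, 0, 0, 0, 0],
             vector [0, 0, -1, -1, 0, 0, 0, 0],
             vector [0, 0, 0, 0, 1, 0, 0, 0],
             vector [0, 0, 0, b, 1, 1, 1, -1]],
     vector [vector [0, -1, 0, -1, 0, 0, 0, 0],
             vector [1, 0, 0, 1, 0, 0, 0, 0],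
             vector [0, 0, 0, 0, 0, 0, 1, 0],
             vector [0, 0, 0, c, 1, 1, 1, -1]])"

lemma glued_diagram_moves_to_split_diagram:
  "(homological_move \<omega>)\<^sup>*\<^sup>* (glued_diagram n (p, q, r))
     (split_diagram (4 * n + 4 + p) (4 * n + 4 + q) (4 * n + 4 + r))"
proof -
  obtain \<alpha> \<beta> \<gamma> where D: "glued_diagram n (p, q, r) = (\<alpha>, \<beta>, \<gamma>)"
    by (metis prod_cases3)
  define \<alpha>' where
    "\<alpha>' = handle_slide 4 1 (-2 * (1 + n)) (handle_slide 4 2 (-1) (handle_slide 2 1 (-1) \<alpha>))"
  define \<beta>' where "\<beta>' = handle_slide 4 2 (-(1 + 2 * n)) (handle_slide 2 1 1 \<beta>)"
  define \<gamma>' where "\<gamma>' = handle_slide 4 1 (-(1 + 2 * n)) (handle_slide 2 1 (-1) \<gamma>)"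
  have distinct: "(4::4) \<noteq> 1" "(4::4) \<noteq> 2" "(2::4) \<noteq> 1"
    by simp_all
  have "(homological_move \<omega>)\<^sup>*\<^sup>* (\<alpha>, \<beta>, \<gamma>) (\<alpha>', \<beta>, \<gamma>)"
    unfolding \<alpha>'_def by (meson distinct multiple_slide_alpha rtranclp_trans)
  also have "(homological_move \<omega>)\<^sup>*\<^sup>* (\<alpha>', \<beta>, \<gamma>) (\<alpha>', \<beta>', \<gamma>)"
    unfolding \<beta>'_def by (meson distinct multiple_slide_beta rtranclp_trans)
  also have "(homological_move \<omega>)\<^sup>*\<^sup>* (\<alpha>', \<beta>', \<gamma>) (\<alpha>', \<beta>', \<gamma>')"
    unfolding \<gamma>'_def by (meson distinct multiple_slide_gamma rtranclp_trans)
  also have "(\<alpha>', \<beta>', \<gamma>') = split_diagram (4 * n + 4 + p) (4 * n + 4 + q) (4 * n + 4 + r)"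
    using D[symmetric]
    unfolding \<alpha>'_def \<beta>'_def \<gamma>'_def split_diagram_def glued_diagram_def handle_slide_def
    by (simp add: vec_eq_iff forall_4 forall_8 vector_4 vector_8 algebra_simps)
  finally show ?thesis
    unfolding D .
qed

text \<open>
  The reindexing makes position \<open>i\<close> for \<open>i = 1, 2, 3\<close> hold the genus 1 summand of the hyperbolic
  pair formed by \<open>e\<^sub>6\<close>, \<open>e\<^sub>5\<close>, \<open>e\<^sub>7\<close>, respectively, and its dual. At position 4 all three families have
  \<open>v\<close> up to a multiple of \<open>e\<^sub>4\<close>, and the hypothesis decides which of the three kinds of standard
  position occurs there.
\<close>

lemma split_diagram_standard:
  assumes "\<epsilon> \<in> {1, -1}"
    and "(b = c \<and> \<bar>a - b\<bar> = 1) \<or> (a = c \<and> \<bar>b - c\<bar> = 1) \<or> (a = b \<and> \<bar>c - a\<bar> = 1)"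
  shows "homologically_standard (intersection_form \<epsilon>) (split_diagram a b c)"
proof -
  obtain \<alpha> \<beta> \<gamma> where D: "split_diagram a b c = (\<alpha>, \<beta>, \<gamma>)"
    by (metis prod_cases3)
  let ?\<alpha> = "reindex (Transposition.transpose 1 3) \<alpha>" and ?\<beta> = "reindex (Transposition.transpose 2 3) \<beta>"
    and ?\<gamma> = "reindex id \<gamma>"
  have alpha:
    "?\<alpha> $ 1 = vector [0, 0, 0, 0, 0, 1, 0, 0]"
    "?\<alpha> $ 2 = vector [1, 0, 0, 1, 0, 0, 0, 0]"
    "?\<alpha> $ 3 = vector [0, 0, -1, -1, 0, 0, 0, 0]"
    "?\<alpha> $ 4 = vector [0, 0, 0, a, 1, 1, 1, -1]"
    using D by (auto simp: split_diagram_def reindex_def vector_4 Transposition.transpose_def)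
  have beta:
    "?\<beta> $ 1 = vector [0, -1, 0, -1, 0, 0, 0, 0]"
    "?\<beta> $ 2 = vector [0, 0, 0, 0, 1, 0, 0, 0]"
    "?\<beta> $ 3 = vector [0, 0, -1, -1, 0, 0, 0, 0]"
    "?\<beta> $ 4 = vector [0, 0, 0, b, 1, 1, 1, -1]"
    using D by (auto simp: split_diagram_def reindex_def vector_4 Transposition.transpose_def)
  have gamma:
    "?\<gamma> $ 1 = vector [0, -1, 0, -1, 0, 0, 0, 0]"
    "?\<gamma> $ 2 = vector [1, 0, 0, 1, 0, 0, 0, 0]"
    "?\<gamma> $ 3 = vector [0, 0, 0, 0, 0, 0, 1, 0]"
    "?\<gamma> $ 4 = vector [0, 0, 0, c, 1, 1, 1, -1]"
    using D by (auto simp: split_diagram_def reindex_def vector_4)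
  note classes = alpha beta gamma
  let ?S = "standard_at (intersection_form \<epsilon>) (?\<alpha>, ?\<beta>, ?\<gamma>)"
  have "?S 1"
    unfolding standard_at_def prod.case forall_4 classes intersection_form_vector
    using assms(1) by auto
  moreover have "?S 2"
    unfolding standard_at_def prod.case forall_4 classes intersection_form_vector
    using assms(1) by auto
  moreover have "?S 3"
    unfolding standard_at_def prod.case forall_4 classes intersection_form_vector
    using assms(1) by auto
  moreover have "?S 4"
    unfolding standard_at_def prod.case forall_4 classes intersection_form_vector
    using assms by (auto simp: abs_if split: if_splits)
  ultimately have "\<forall>i. ?S i"
    unfolding forall_4 by blast
  then show ?thesis
    unfolding homologically_standard_def D by (meson bij_transpose bij_id rtranclp.rtrancl_refl)
qed

theorem theorem1p2:
  fixes n \<epsilon> :: int and x :: arc_label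
  assumes "n \<ge> 1" and "\<epsilon> \<in> {1, -1}"
  shows "homologically_standard (intersection_form \<epsilon>) (gluck_diagram x n) \<and>
         homologically_standard (intersection_form \<epsilon>) (gluck_diagram_mirror x n)"
proof -
  have "homologically_standard (intersection_form \<epsilon>) (glued_diagram n (twist_on x t))"
    if "t \<in> {1, -1}" for t
  proof -
    obtain p q r where pqr: "twist_on x t = (p, q, r)"
      by (metis prod_cases3)
    have "(q = r \<and> \<bar>p - q\<bar> = 1) \<or> (p = r \<and> \<bar>q - r\<bar> = 1) \<or> (p = q \<and> \<bar>r - p\<bar> = 1)"
      using pqr that by (cases x) auto
    then show ?thesis
      unfolding pqr
      by (intro homologically_standard_if_moves[OF glued_diagram_moves_to_split_diagram]
            split_diagram_standard assms) auto
  qed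
  then show ?thesis
    unfolding gluck_diagram_def gluck_diagram_mirror_def by simp
qed

end
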